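(* Let $\mathscr R$ be the supertropical real $\nu$-semifield$^\dagger$ and $\Lambda=\{\lambda_1,\dots,\lambda_n\}$. If $f\in\mathscr R(\Lambda)$ satisfies $\langle f\rangle\subseteq\langle\mathscr R\rangle$ and $h\in\langle f\rangle$ is such that $1_{\mathrm{loc}}(h)=1_{\mathrm{loc}}(f)$, then $h$ is a generator of the $\nu$-kernel $\langle f\rangle$.
   Context: **Supertropical reals.** $\mathscr R=\mathcal T\sqcup\mathcal G$, where $\mathcal T$ is the ordered group $(\mathbb R,+)$ written multiplicatively (unit $1$) and $\mathcal G$ is a second (ghost) copy; $\nu:\mathscr R\to\mathcal G$, $a\mapsto a^\nu$, is the identity on $\mathcal G$ and the identification on $\mathcal T$; $ab^\nu=a^\nu b=a^\nu b^\nu=(ab)^\nu$; and $a+b$ is whichever of $a,b$ has larger $\nu$-value, or $a^\nu$ if $a^\nu=b^\nu$. Write $a\cong_\nu b$ if $a^\nu=b^\nu$ and $a\ge_\nu b$ if $a^\nu\ge b^\nu$. For $a\in\mathcal T$ put $a^*=a^{-1}$, $(a^\nu)^*=(a^{-1})^\nu$. **Rational functions.** $\mathscr R(\Lambda)$ consists of the functions $\mathscr R^{(n)}\to\mathscr R$ of the form $\mathbf a\mapsto h(\mathbf a)g(\mathbf a)^*$ with $h$ a polynomial over $\mathscr R$ and $g$ a polynomial with tangible coefficients (max-plus-type rational functions), with pointwise operations. **Kernels.** A $\nu$-kernel of $\mathscr R(\Lambda)$ is a subgroup $K$ (closed under products and $*$) such that $a,b\in K$, $\alpha+\beta\cong_\nu1$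 imply $\alpha a+\beta b\in K$; these are handled up to $\cong_\nu$. $\langle S\rangle$ is the $\nu$-kernel generated by $S$; $\langle\mathscr R\rangle$ is the $\nu$-kernel generated by the constants. $1_{\mathrm{loc}}(f)=\{\mathbf a\in\mathscr R^{(n)}: f(\mathbf a)\cong_\nu1\}$. $h$ is a generator of $\langle f\rangle$ if $\langle h\rangle=\langle f\rangle$. *)

theory Defs
  imports Complex_Main "HOL-Library.Function_Algebras"
begin

text \<open>The supertropical reals. \<open>Tangible x\<close> and \<open>Ghost x\<close> are the two copies of the
  real \<open>x\<close>, written additively inside the constructors; there is no zero element.\<close>

datatype strop = Tangible (level: real) | Ghost (level: real)

definition nu :: "strop \<Rightarrow> strop" where
  "nu a = Ghost (level a)"

definition star :: "strop \<Rightarrow> strop" where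
  "star a = (case a of Tangible x \<Rightarrow> Tangible (- x) | Ghost x \<Rightarrow> Ghost (- x))"

instantiation strop :: "{comm_semiring, comm_monoid_mult}"
begin

definition one_strop :: strop where
  "1 = Tangible 0"

definition times_strop :: "strop \<Rightarrow> strop \<Rightarrow> strop" where
  "a * b = (case (a, b) of
      (Tangible x, Tangible y) \<Rightarrow> Tangible (x + y)
    | _ \<Rightarrow> Ghost (level a + level b))"

definition plus_strop :: "strop \<Rightarrow> strop \<Rightarrow> strop" where
  "a + b = (if level b < level a then a else if level a < level b then b else nu a)"

instance
  by standard
    (auto simp: one_strop_def times_strop_def plus_strop_def nu_def split: strop.splits)

end

definition nu_cong :: "('x \<Rightarrow> strop) \<Rightarrow> ('x \<Rightarrow> strop) \<Rightarrow> bool" (infix "\<cong>\<^sub>\<nu>" 50) where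
  "f \<cong>\<^sub>\<nu> g \<longleftrightarrow> (\<forall>x. nu (f x) = nu (g x))"

text \<open>Since \<open>strop\<close> has no zero, \<^const>\<open>sum\<close> is unavailable. \<open>ne_sum f A\<close> is the sum over a
  finite nonempty set \<open>A\<close>, with \<^const>\<open>None\<close> as a formal neutral start value.\<close>

definition ne_sum :: "('i \<Rightarrow> 'a::ab_semigroup_add) \<Rightarrow> 'i set \<Rightarrow> 'a" where
  "ne_sum f A = the (Finite_Set.fold
     (\<lambda>i s. Some (case s of None \<Rightarrow> f i | Some t \<Rightarrow> f i + t)) None A)"

lemma comp_fun_commute_ne_sum:
  "comp_fun_commute
     (\<lambda>i s. Some (case s of None \<Rightarrow> f i | Some t \<Rightarrow> f i + (t::'a::ab_semigroup_add)))"
  by standard (auto simp: fun_eq_iff add_ac split: option.splits)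

lemma ne_sum_singleton [simp]: "ne_sum f {i} = f i"
proof -
  interpret comp_fun_commute "\<lambda>i s. Some (case s of None \<Rightarrow> f i | Some t \<Rightarrow> f i + t)"
    by (rule comp_fun_commute_ne_sum)
  show ?thesis by (simp add: ne_sum_def)
qed

lemma ne_sum_insert:
  assumes "finite A" "A \<noteq> {}" "i \<notin> A"
  shows "ne_sum f (insert i A) = f i + ne_sum f A"
proof -
  interpret comp_fun_commute "\<lambda>i s. Some (case s of None \<Rightarrow> f i | Some t \<Rightarrow> f i + t)"
    by (rule comp_fun_commute_ne_sum)
  from assms(2) obtain j B where "A = insert j B" "j \<notin> B"
    by (meson all_not_in_conv mk_disjoint_insert)
  with assms show ?thesis by (simp add: ne_sum_def)
qed

text \<open>A polynomial in the variables indexed by \<open>'n\<close> assigns coefficients to finitely many, and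
  at least one, exponent vectors; an absent monomial is an exponent outside the domain.\<close>

type_synonym 'n trop_poly = "('n \<Rightarrow> nat) \<rightharpoonup> strop"

definition is_poly :: "'n trop_poly \<Rightarrow> bool" where
  "is_poly p \<longleftrightarrow> finite (dom p) \<and> dom p \<noteq> {}"

definition tangible_coeffs :: "'n trop_poly \<Rightarrow> bool" where
  "tangible_coeffs p \<longleftrightarrow> ran p \<subseteq> range Tangible"

definition poly_eval :: "'n::finite trop_poly \<Rightarrow> ('n \<Rightarrow> strop) \<Rightarrow> strop" where
  "poly_eval p a = ne_sum (\<lambda>e. the (p e) * (\<Prod>i\<in>UNIV. a i ^ e i)) (dom p)"

definition ratfun :: "(('n::finite \<Rightarrow> strop) \<Rightarrow> strop) set" where
  "ratfun = {\<lambda>a. poly_eval h a * star (poly_eval g a) | h g.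
     is_poly h \<and> is_poly g \<and> tangible_coeffs g}"

text \<open>A pointwise sum of elements of \<^const>\<open>ratfun\<close> need not literally be in \<^const>\<open>ratfun\<close>, since
  its ghost locus can have the wrong shape, but it is always \<open>\<cong>\<^sub>\<nu>\<close> to an element of it. Kernels are
  taken up to \<open>\<cong>\<^sub>\<nu>\<close>: the last clause puts every representative \<open>c\<close> of \<open>\<alpha> a + \<beta> b\<close> in \<open>K\<close>.
  With \<open>\<alpha> = \<beta> = 1\<close> and \<open>a = b\<close> it says that \<open>K\<close> is closed under \<open>\<cong>\<^sub>\<nu>\<close> in \<^const>\<open>ratfun\<close>.\<close>

definition is_nu_kernel :: "(('n::finite \<Rightarrow> strop) \<Rightarrow> strop) set \<Rightarrow> bool" where
  "is_nu_kernel K \<longleftrightarrow>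
     K \<subseteq> ratfun \<and>
     1 \<in> K \<and>
     (\<forall>a\<in>K. \<forall>b\<in>K. a * b \<in> K) \<and>
     (\<forall>a\<in>K. star \<circ> a \<in> K) \<and>
     (\<forall>a\<in>K. \<forall>b\<in>K. \<forall>\<alpha>\<in>ratfun. \<forall>\<beta>\<in>ratfun. \<alpha> + \<beta> \<cong>\<^sub>\<nu> 1 \<longrightarrow>
        (\<forall>c\<in>ratfun. c \<cong>\<^sub>\<nu> \<alpha> * a + \<beta> * b \<longrightarrow> c \<in> K))"

definition nu_kernel_gen ::
  "(('n::finite \<Rightarrow> strop) \<Rightarrow> strop) set \<Rightarrow> (('n \<Rightarrow> strop) \<Rightarrow> strop) set" where
  "nu_kernel_gen S = is_nu_kernel hull S"

definition constants :: "(('n::finite \<Rightarrow> strop) \<Rightarrow> strop) set" where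
  "constants = range (\<lambda>c a. c)"

definition one_loc :: "(('n::finite \<Rightarrow> strop) \<Rightarrow> strop) \<Rightarrow> ('n \<Rightarrow> strop) set" where
  "one_loc f = {a. nu (f a) = nu 1}"

definition is_generator ::
  "(('n::finite \<Rightarrow> strop) \<Rightarrow> strop) \<Rightarrow> (('n \<Rightarrow> strop) \<Rightarrow> strop) set \<Rightarrow> bool" where
  "is_generator h K \<longleftrightarrow> nu_kernel_gen {h} = K"

end

theory Submission
  imports Defs "HOL-Analysis.Analysis"
begin

text \<open>The level of a rational function is a piecewise affine function of the levels of its
  arguments. The bounded rational functions form a kernel containing the constants, so \<open>f\<close> is
  bounded. On each of the finitely many polyhedral cells where \<open>f\<close> and \<open>h\<close> are affine and do not
  change sign, Farkas' lemma turns the inclusion of zero sets, together with the boundedness of \<open>f\<close>,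
  into an inequality \<open>\<bar>f\<bar> \<le> N \<bar>h\<bar>\<close>. A kernel containing \<open>h\<close> contains \<open>\<bar>h\<bar>\<close>, represented by
  \<open>h + h\<^sup>*\<close>, and hence every rational function between \<open>- N \<bar>h\<bar>\<close> and \<open>N \<bar>h\<bar>\<close>; in particular \<open>f\<close>.\<close>

subsection \<open>Piecewise affine functions\<close>

text \<open>A finitely generated convex cone is closed, so a point outside it can be strictly
  separated from it. Since the cone contains 0 and is stable under scaling, the separating
  functional is nonnegative on the generators but negative at \<open>z\<close>.\<close>

lemma farkas_cone:
  fixes S :: "'a::euclidean_space set"
  assumes "finite S" and "\<And>w. (\<And>s. s \<in> S \<Longrightarrow> 0 \<le> s \<bullet> w) \<Longrightarrow> 0 \<le> z \<bullet> w"
  shows "z \<in> convex_cone hull S"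
proof (rule ccontr)
  let ?C = "convex_cone hull S"
  assume "z \<notin> ?C"
  then obtain w b where wz: "w \<bullet> z < b" and wC: "\<And>x. x \<in> ?C \<Longrightarrow> b < w \<bullet> x"
    using separating_hyperplane_closed_point[OF convex_convex_cone_hull closed_convex_cone_hull[OF assms(1)]]
    by metis
  have "b < 0"
    using wC[OF convex_cone_hull_contains_0] by simp
  have "0 \<le> s \<bullet> w" if "s \<in> S" for s
  proof (rule ccontr)
    assume "\<not> 0 \<le> s \<bullet> w"
    then have neg: "w \<bullet> s < 0"
      by (simp add: inner_commute)
    with \<open>b < 0\<close> have "0 \<le> b / (w \<bullet> s)"
      by (simp add: divide_nonpos_neg)
    \<comment> \<open>The factor is chosen so that this point of the cone pairs with
      \<open>w\<close> to exactly \<open>b\<close>, against the strict separation.\<close>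
    then have "(b / (w \<bullet> s)) *\<^sub>R s \<in> ?C"
      by (intro convex_cone_hull_mul hull_inc that)
    from wC[OF this] neg show False
      by simp
  qed
  then have "0 \<le> z \<bullet> w"
    by (rule assms(2))
  with wz \<open>b < 0\<close> show False
    by (simp add: inner_commute)
qed

text \<open>A pair \<open>(v, c)\<close> stands for the affine function \<open>y \<mapsto> v \<bullet> y + c = (v, c) \<bullet> (y, 1)\<close>.\<close>

abbreviation affine_val :: "'a::euclidean_space \<times> real \<Rightarrow> 'a \<Rightarrow> real" (infix "\<odot>" 70) where
  "a \<odot> y \<equiv> a \<bullet> (y, 1)"

section \<open>Polyhedral cells and functions that are affine on them\<close>

definition cell :: "('a::euclidean_space \<times> real) set \<Rightarrow> 'a set" where
  "cell A = {y. \<forall>a\<in>A. 0 \<le> a \<odot> y}"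

text \<open>The cells are closed and may overlap or be empty. Because \<open>F\<close> agrees with
  its piece on the whole cell, the pieces agree on overlaps.\<close>

definition piecewise_affine :: "('a::euclidean_space \<Rightarrow> real) \<Rightarrow> bool" where
  "piecewise_affine F \<longleftrightarrow> (\<exists>C. finite C \<and> (\<forall>y. \<exists>(A, g)\<in>C. y \<in> cell A) \<and>
     (\<forall>(A, g)\<in>C. finite A \<and> (\<forall>y\<in>cell A. F y = g \<odot> y)))"

lemma piecewise_affineE:
  assumes "piecewise_affine F"
  obtains C where "finite C" "\<And>y. \<exists>A g. (A, g) \<in> C \<and> y \<in> cell A"
    "\<And>A g. (A, g) \<in> C \<Longrightarrow> finite A"
    "\<And>A g y. (A, g) \<in> C \<Longrightarrow> y \<in> cell A \<Longrightarrow> F y = g \<odot> y"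
proof -
  from assms obtain C where "finite C" and cover: "\<forall>y. \<exists>(A, g)\<in>C. y \<in> cell A"
    and *: "\<forall>(A, g)\<in>C. finite A \<and> (\<forall>y\<in>cell A. F y = g \<odot> y)"
    unfolding piecewise_affine_def by (elim exE conjE)
  show thesis
  proof (rule that[OF \<open>finite C\<close>])
    show "\<exists>A g. (A, g) \<in> C \<and> y \<in> cell A" for y
      using spec[OF cover, of y] by auto
  qed (use * in auto)
qed

lemma piecewise_affineI:
  assumes "finite C" "\<And>y. \<exists>A g. (A, g) \<in> C \<and> y \<in> cell A"
    "\<And>A g. (A, g) \<in> C \<Longrightarrow> finite A"
    "\<And>A g y. (A, g) \<in> C \<Longrightarrow> y \<in> cell A \<Longrightarrow> F y = g \<odot> y"
  shows "piecewise_affine F"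
  unfolding piecewise_affine_def
proof (intro exI[of _ C] conjI allI)
  show "\<exists>(A, g)\<in>C. y \<in> cell A" for y
    using assms(2)[of y] by auto
qed (use assms in auto)

lemma cell_Un: "cell (A \<union> B) = cell A \<inter> cell B"
  by (auto simp: cell_def)

lemma cell_insert: "y \<in> cell (insert a A) \<longleftrightarrow> 0 \<le> a \<odot> y \<and> y \<in> cell A"
  by (auto simp: cell_def)

text \<open>The vectors \<open>z\<close> that satisfy the conclusion form a convex cone. It contains
  \<open>(0, 1)\<close> and the constraints with \<open>c = 0\<close>, and \<open>- h\<close> with
  \<open>c = 1\<close>, hence the whole hull.\<close>

lemma convex_cone_hull_cell:
  fixes h :: "'a::euclidean_space \<times> real"
  assumes "z \<in> convex_cone hull insert (0, 1) (insert (- h) A)"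
  shows "\<exists>c\<ge>0. \<forall>y\<in>cell A. 0 \<le> z \<odot> y + c * (h \<odot> y)"
proof -
  define Z where "Z = {z. \<exists>c\<ge>0. \<forall>y\<in>cell A. 0 \<le> z \<odot> y + c * (h \<odot> y)}"
  have "convex_cone Z"
    unfolding convex_cone_iff
  proof (intro conjI ballI allI impI)
    show "0 \<in> Z"
      by (auto simp: Z_def intro: exI[of _ 0])
  next
    fix x x' assume "x \<in> Z" "x' \<in> Z"
    then obtain c c' where "c \<ge> 0" "c' \<ge> 0"
      "\<forall>y\<in>cell A. 0 \<le> x \<odot> y + c * (h \<odot> y)"
      "\<forall>y\<in>cell A. 0 \<le> x' \<odot> y + c' * (h \<odot> y)"
      by (auto simp: Z_def)
    then show "x + x' \<in> Z"
      unfolding Z_def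
      by (intro CollectI exI[of _ "c + c'"]) (fastforce simp: inner_add_left algebra_simps)
  next
    fix x and r :: real assume "x \<in> Z" "0 \<le> r"
    then obtain c where "c \<ge> 0" and c: "\<forall>y\<in>cell A. 0 \<le> x \<odot> y + c * (h \<odot> y)"
      by (auto simp: Z_def)
    have "0 \<le> (r *\<^sub>R x) \<odot> y + (r * c) * (h \<odot> y)" if "y \<in> cell A" for y
    proof -
      have "0 \<le> r * (x \<odot> y + c * (h \<odot> y))"
        using c that \<open>0 \<le> r\<close> by (intro mult_nonneg_nonneg) auto
      then show ?thesis
        by (simp only: inner_scaleR_left distrib_left mult.assoc)
    qed
    then show "r *\<^sub>R x \<in> Z"
      using \<open>c \<ge> 0\<close> \<open>0 \<le> r\<close> unfolding Z_def by (intro CollectI exI[of _ "r * c"]) auto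
  qed
  moreover have "insert (0, 1) (insert (- h) A) \<subseteq> Z"
  proof (intro subsetI)
    fix x assume "x \<in> insert (0, 1) (insert (- h) A)"
    then consider "x = (0, 1)" | "x = - h" | "x \<in> A"
      by auto
    then show "x \<in> Z"
    proof cases
      case 2
      then show ?thesis
        by (auto simp: Z_def intro!: exI[of _ 1])
    qed (auto simp: Z_def cell_def intro!: exI[of _ 0])
  qed
  ultimately have "convex_cone hull insert (0, 1) (insert (- h) A) \<subseteq> Z"
    by (intro hull_minimal)
  with assms show ?thesis
    by (auto simp: Z_def)
qed

text \<open>Farkas' lemma gives the multiplier \<open>N\<close>: if \<open>h \<le> 0\<close> is solvable on the cell then \<open>- g\<close> is
  a nonnegative combination of \<open>- h\<close>, the constraints and \<open>1\<close>; otherwise \<open>- 1\<close> is, so that \<open>h\<close>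
  has a positive lower bound.\<close>

lemma affine_le_multiple_on_cell:
  fixes g h :: "'a::euclidean_space \<times> real"
  assumes "finite A"
    and bdd: "\<And>y. y \<in> cell A \<Longrightarrow> g \<odot> y \<le> M"
    and zero: "\<And>y. y \<in> cell A \<Longrightarrow> h \<odot> y \<le> 0 \<Longrightarrow> g \<odot> y \<le> 0"
  shows "\<exists>N\<ge>0. \<forall>y\<in>cell A. g \<odot> y \<le> N * (h \<odot> y)"
proof -
  let ?S = "insert (0, 1) (insert (- h) A)"
  have fin: "finite ?S"
    using assms(1) by simp
  \<comment> \<open>Dehomogenization: a vector with positive last coordinate that satisfies the
    homogeneous constraints is a multiple of some \<open>(y', 1)\<close>, with \<open>y'\<close> in
    the cell and \<open>h\<close> nonpositive there.\<close>
  have scaled: "y /\<^sub>R t \<in> cell A \<and> h \<odot> (y /\<^sub>R t) \<le> 0"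
    if "0 < t" and S: "\<And>s. s \<in> ?S \<Longrightarrow> 0 \<le> s \<bullet> (y, t)" for y t
  proof -
    have eq: "(y /\<^sub>R t, 1) = (y, t) /\<^sub>R t"
      using that by simp
    have "0 \<le> s \<odot> (y /\<^sub>R t)" if "s \<in> ?S" for s
      using S[OF that] \<open>0 < t\<close> unfolding eq inner_scaleR_right by simp
    from this[of "- h"] this show ?thesis
      by (auto simp: cell_def)
  qed
  show ?thesis
  proof (cases "\<exists>y\<in>cell A. h \<odot> y \<le> 0")
    case True
    then obtain y0 where y0: "y0 \<in> cell A" "h \<odot> y0 \<le> 0" by blast
    have "- g \<in> convex_cone hull ?S"
    proof (rule farkas_cone[OF fin])
      fix w assume w: "\<And>s. s \<in> ?S \<Longrightarrow> 0 \<le> s \<bullet> w"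
      obtain y t where wyt: "w = (y, t)" by force
      have "0 \<le> t"
        using w[of "(0, 1)"] by (simp add: wyt)
      show "0 \<le> - g \<bullet> w"
      proof (cases "t = 0")
        case False
        with \<open>0 \<le> t\<close> have t: "0 < t" by simp
        have "g \<odot> (y /\<^sub>R t) \<le> 0"
          using scaled[OF t, of y] w zero unfolding wyt by blast
        moreover have "g \<bullet> w = t * (g \<odot> (y /\<^sub>R t))"
        proof -
          have "w = t *\<^sub>R (y /\<^sub>R t, 1)"
            using t by (simp add: wyt)
          then show ?thesis
            by (metis inner_scaleR_right)
        qed
        ultimately show ?thesis
          using t by (simp add: mult_nonneg_nonpos)
      next
        case True
        \<comment> \<open>For \<open>t = 0\<close> the vector is a direction of recession. The ray
          from \<open>y0\<close> along \<open>y\<close> stays in the cell and keeps \<open>h\<close>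
          nonpositive, so \<open>g\<close> stays nonpositive on it and cannot have positive
          slope.\<close>
        have shift: "s \<odot> (y0 + r *\<^sub>R y) = s \<odot> y0 + r * (s \<bullet> w)" for s r
        proof -
          have "(y0 + r *\<^sub>R y, 1) = (y0, 1) + r *\<^sub>R w"
            by (simp add: wyt True)
          then show ?thesis
            by (simp only: inner_add_right inner_scaleR_right)
        qed
        have nonpos: "g \<odot> y0 + r * (g \<bullet> w) \<le> 0" if "0 \<le> r" for r
        proof -
          have "0 \<le> s \<odot> (y0 + r *\<^sub>R y)" if "s \<in> A" for s
            using w[of s] that y0(1) \<open>0 \<le> r\<close> unfolding shift by (auto simp: cell_def)
          then have "y0 + r *\<^sub>R y \<in> cell A"
            unfolding cell_def by blast
          moreover have "r * (h \<bullet> w) \<le> 0"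
            using w[of "- h"] \<open>0 \<le> r\<close> by (simp add: mult_nonneg_nonpos)
          then have "h \<odot> (y0 + r *\<^sub>R y) \<le> 0"
            using y0(2) unfolding shift by linarith
          ultimately show ?thesis
            using zero[of "y0 + r *\<^sub>R y"] unfolding shift by blast
        qed
        have "g \<bullet> w \<le> 0"
        proof (rule ccontr)
          assume "\<not> g \<bullet> w \<le> 0"
          then have "0 < g \<bullet> w" by simp
          \<comment> \<open>This value of \<open>r\<close> makes \<open>r * (g \<bullet> w)\<close>
            equal to \<open>1 + \<bar>g \<odot> y0\<bar>\<close>, enough to outweigh
            \<open>g \<odot> y0\<close>.\<close>
          then have "g \<odot> y0 + (1 + \<bar>g \<odot> y0\<bar>) \<le> 0"
            using nonpos[of "(1 + \<bar>g \<odot> y0\<bar>) / (g \<bullet> w)"] by simp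
          then show False by linarith
        qed
        then show ?thesis by simp
      qed
    qed
    from convex_cone_hull_cell[OF this] show ?thesis
      by auto
  next
    case False
    \<comment> \<open>Here \<open>h\<close> is positive on the cell, which may be empty, so by
      \<open>scaled\<close> the homogeneous system has no solution with \<open>t > 0\<close>. The
      resulting \<open>c\<close> satisfies \<open>c * h \<ge> 1\<close> on the cell.\<close>
    have "(0, - 1) \<in> convex_cone hull ?S"
    proof (rule farkas_cone[OF fin])
      fix w :: "'a \<times> real" assume w: "\<And>s. s \<in> ?S \<Longrightarrow> 0 \<le> s \<bullet> w"
      obtain y t where wyt: "w = (y, t)" by force
      have "\<not> 0 < t"
        using scaled[of t y] w False unfolding wyt by blast
      then show "0 \<le> (0, - 1) \<bullet> w"
        by (simp add: wyt)
    qed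
    from convex_cone_hull_cell[OF this] obtain c
      where c: "c \<ge> 0" "\<And>y. y \<in> cell A \<Longrightarrow> 1 \<le> c * (h \<odot> y)"
      by auto
    \<comment> \<open>Boundedness of \<open>g\<close> enters here: \<open>g\<close> is at most
      \<open>\<bar>M\<bar>\<close>, and \<open>c * h\<close> is at least 1.\<close>
    have "g \<odot> y \<le> \<bar>M\<bar> * c * (h \<odot> y)" if "y \<in> cell A" for y
    proof -
      have "g \<odot> y \<le> \<bar>M\<bar> * 1"
        using bdd[OF that] by simp
      also have "\<dots> \<le> \<bar>M\<bar> * (c * (h \<odot> y))"
        using c(2)[OF that] by (intro mult_left_mono) auto
      finally show ?thesis by (simp add: mult.assoc)
    qed
    then show ?thesis
      using c(1) by (intro exI[of _ "\<bar>M\<bar> * c"]) auto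
  qed
qed

text \<open>On the intersection of a cell of \<open>F\<close> with a cell of \<open>H\<close> both
  functions are affine. Nonnegativity of \<open>H\<close> turns \<open>h \<le> 0\<close> into
  \<open>H = 0\<close>, so the estimate on a single cell applies to each of the finitely many
  intersections.\<close>

lemma piecewise_affine_le_multiple:
  assumes F: "piecewise_affine F" and H: "piecewise_affine H"
    and H0: "\<And>y. 0 \<le> H y" and M: "\<And>y. F y \<le> M"
    and zero: "\<And>y. H y = 0 \<Longrightarrow> F y \<le> 0"
  shows "\<exists>N\<ge>0. \<forall>y. F y \<le> N * H y"
proof -
  from F obtain C where C: "finite C" "\<And>y. \<exists>A g. (A, g) \<in> C \<and> y \<in> cell A"
    "\<And>A g. (A, g) \<in> C \<Longrightarrow> finite A"
    "\<And>A g y. (A, g) \<in> C \<Longrightarrow> y \<in> cell A \<Longrightarrow> F y = g \<odot> y"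
    by (rule piecewise_affineE) blast
  from H obtain D where D: "finite D" "\<And>y. \<exists>A g. (A, g) \<in> D \<and> y \<in> cell A"
    "\<And>A g. (A, g) \<in> D \<Longrightarrow> finite A"
    "\<And>A g y. (A, g) \<in> D \<Longrightarrow> y \<in> cell A \<Longrightarrow> H y = g \<odot> y"
    by (rule piecewise_affineE) blast
  have "\<exists>N\<ge>0. \<forall>y\<in>cell (fst p) \<inter> cell (fst q). F y \<le> N * H y" if "p \<in> C" "q \<in> D" for p q
  proof -
    obtain A g B h where pq: "p = (A, g)" "q = (B, h)"
      by (meson surj_pair)
    have FH: "F y = g \<odot> y" "H y = h \<odot> y" if "y \<in> cell (A \<union> B)" for y
      using that C(4) D(4) \<open>p \<in> C\<close> \<open>q \<in> D\<close> by (auto simp: cell_Un pq)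
    have "\<exists>N\<ge>0. \<forall>y\<in>cell (A \<union> B). g \<odot> y \<le> N * (h \<odot> y)"
    proof (rule affine_le_multiple_on_cell)
      show "finite (A \<union> B)"
        using C(3) D(3) that pq by blast
      show "g \<odot> y \<le> M" if "y \<in> cell (A \<union> B)" for y
        using FH(1)[OF that] M by metis
      show "g \<odot> y \<le> 0" if "y \<in> cell (A \<union> B)" "h \<odot> y \<le> 0" for y
        using FH[OF that(1)] H0[of y] that(2) zero[of y] by linarith
    qed
    then show ?thesis
      using FH by (simp add: pq cell_Un)
  qed
  then obtain N where N: "\<And>p q. p \<in> C \<Longrightarrow> q \<in> D \<Longrightarrow> N p q \<ge> 0"
    "\<And>p q y. p \<in> C \<Longrightarrow> q \<in> D \<Longrightarrow> y \<in> cell (fst p) \<Longrightarrow> y \<in> cell (fst q) \<Longrightarrow> F y \<le> N p q * H y"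
    by (metis IntI)
  \<comment> \<open>The multipliers are nonnegative, so their sum dominates each of them and serves
    all pairs of cells at once.\<close>
  let ?N = "\<Sum>p\<in>C. \<Sum>q\<in>D. N p q"
  have "F y \<le> ?N * H y" for y
  proof -
    obtain p q where pq: "p \<in> C" "q \<in> D" "y \<in> cell (fst p)" "y \<in> cell (fst q)"
      using C(2)[of y] D(2)[of y] by (metis fst_conv)
    have "N p q \<le> (\<Sum>q\<in>D. N p q)"
      using D(1) pq N(1) by (intro member_le_sum) auto
    also have "\<dots> \<le> ?N"
      using C(1) pq N(1) by (intro member_le_sum[where f = "\<lambda>p. \<Sum>q\<in>D. N p q"]) (auto intro: sum_nonneg)
    finally have "N p q * H y \<le> ?N * H y"
      by (intro mult_right_mono H0)
    then show ?thesis
      using N(2)[OF pq] by linarith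
  qed
  moreover have "0 \<le> ?N"
    using N(1) by (intro sum_nonneg) auto
  ultimately show ?thesis by blast
qed

section \<open>Maxima, differences and absolute values of piecewise affine functions\<close>

lemma piecewise_affine_Max:
  assumes "finite S" "S \<noteq> {}"
  shows "piecewise_affine (\<lambda>y. Max ((\<lambda>s. s \<odot> y) ` S))"
proof (rule piecewise_affineI)
  \<comment> \<open>The cell attached to \<open>s\<close> is the region where \<open>s\<close>
    dominates all the other affine functions.\<close>
  let ?C = "(\<lambda>s. ((\<lambda>t. s - t) ` S, s)) ` S"
  show "finite ?C"
    using assms by simp
  show "\<exists>A g. (A, g) \<in> ?C \<and> y \<in> cell A" for y
  proof -
    have "Max ((\<lambda>s. s \<odot> y) ` S) \<in> (\<lambda>s. s \<odot> y) ` S"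
      using assms by (intro Max_in) auto
    then obtain s where s: "s \<in> S" "Max ((\<lambda>s. s \<odot> y) ` S) = s \<odot> y"
      by blast
    have "t \<odot> y \<le> s \<odot> y" if "t \<in> S" for t
      using Max_ge[of "(\<lambda>s. s \<odot> y) ` S" "t \<odot> y"] assms that s(2) by auto
    then have "y \<in> cell ((\<lambda>t. s - t) ` S)"
      by (auto simp: cell_def inner_diff_left)
    with s(1) show ?thesis by blast
  qed
  show "Max ((\<lambda>s. s \<odot> y) ` S) = g \<odot> y" if "(A, g) \<in> ?C" "y \<in> cell A" for A g y
  proof -
    have "g \<in> S" and "\<forall>t\<in>S. t \<odot> y \<le> g \<odot> y"
      using that by (auto simp: cell_def inner_diff_left simp del: inner_Pair)
    then show ?thesis
      using assms(1) by (intro Max_eqI) auto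
  qed
qed (use assms in auto)

lemma piecewise_affine_diff:
  assumes F: "piecewise_affine F" and H: "piecewise_affine H"
  shows "piecewise_affine (\<lambda>y. F y - H y)"
proof -
  from F obtain C where C: "finite C" "\<And>y. \<exists>A g. (A, g) \<in> C \<and> y \<in> cell A"
    "\<And>A g. (A, g) \<in> C \<Longrightarrow> finite A"
    "\<And>A g y. (A, g) \<in> C \<Longrightarrow> y \<in> cell A \<Longrightarrow> F y = g \<odot> y"
    by (rule piecewise_affineE) blast
  from H obtain D where D: "finite D" "\<And>y. \<exists>A g. (A, g) \<in> D \<and> y \<in> cell A"
    "\<And>A g. (A, g) \<in> D \<Longrightarrow> finite A"
    "\<And>A g y. (A, g) \<in> D \<Longrightarrow> y \<in> cell A \<Longrightarrow> H y = g \<odot> y"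
    by (rule piecewise_affineE) blast
  show ?thesis
  proof (rule piecewise_affineI)
    \<comment> \<open>Common refinement: the constraints of both cells are imposed together.\<close>
    let ?E = "(\<lambda>((A, g), (B, h)). (A \<union> B, g - h)) ` (C \<times> D)"
    show "finite ?E"
      using C(1) D(1) by simp
    show "\<exists>A g. (A, g) \<in> ?E \<and> y \<in> cell A" for y
    proof -
      obtain A g B h where "(A, g) \<in> C" "(B, h) \<in> D" "y \<in> cell A" "y \<in> cell B"
        using C(2) D(2) by meson
      then have "(A \<union> B, g - h) \<in> ?E" "y \<in> cell (A \<union> B)"
        by (auto simp: cell_Un intro!: rev_image_eqI[of "((A, g), (B, h))"])
      then show ?thesis by blast
    qed
  qed (use C(3,4) D(3,4) in \<open>auto simp: cell_Un inner_diff_left\<close>)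
qed

lemma piecewise_affine_abs:
  assumes F: "piecewise_affine F"
  shows "piecewise_affine (\<lambda>y. \<bar>F y\<bar>)"
proof -
  from F obtain C where C: "finite C" "\<And>y. \<exists>A g. (A, g) \<in> C \<and> y \<in> cell A"
    "\<And>A g. (A, g) \<in> C \<Longrightarrow> finite A"
    "\<And>A g y. (A, g) \<in> C \<Longrightarrow> y \<in> cell A \<Longrightarrow> F y = g \<odot> y"
    by (rule piecewise_affineE) blast
  show ?thesis
  proof (rule piecewise_affineI)
    \<comment> \<open>Each cell is cut in two by the sign of its affine piece.\<close>
    let ?E = "(\<lambda>(A, g). (insert g A, g)) ` C \<union> (\<lambda>(A, g). (insert (- g) A, - g)) ` C"
    show "finite ?E"
      using C(1) by simp
    show "\<exists>A g. (A, g) \<in> ?E \<and> y \<in> cell A" for y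
    proof -
      obtain A g where Ag: "(A, g) \<in> C" "y \<in> cell A"
        using C(2) by meson
      then have "(insert g A, g) \<in> ?E" "(insert (- g) A, - g) \<in> ?E"
        by (auto intro: rev_image_eqI)
      moreover have "y \<in> cell (insert g A) \<or> y \<in> cell (insert (- g) A)"
        using Ag(2) by (auto simp: cell_insert)
      ultimately show ?thesis by blast
    qed
  qed (use C(3,4) in \<open>auto simp: cell_insert\<close>)
qed

subsection \<open>Polynomials and rational functions over the supertropical reals\<close>

text \<open>Splits every identity in \<open>strop\<close> into a linear statement about levels and a
  propositional one about tangibility.\<close>

lemma strop_eqI:
  assumes "level a = level b" "is_Tangible a \<longleftrightarrow> is_Tangible b"
  shows "a = b"
  using assms by (cases a; cases b) auto

lemma level_mult [simp]: "level (a * b) = level a + level b"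
  by (auto simp: times_strop_def split: strop.splits)

lemma is_Tangible_mult [simp]: "is_Tangible (a * b) \<longleftrightarrow> is_Tangible a \<and> is_Tangible b"
  by (auto simp: times_strop_def split: strop.splits)

lemma level_plus [simp]: "level (a + b) = max (level a) (level b)"
  by (auto simp: plus_strop_def nu_def)

lemma is_Tangible_plus:
  "is_Tangible (a + b) \<longleftrightarrow>
     is_Tangible a \<and> level b < level a \<or> is_Tangible b \<and> level a < level b"
  by (auto simp: plus_strop_def nu_def)

lemma level_one [simp]: "level 1 = 0"
  and is_Tangible_one [simp]: "is_Tangible 1"
  by (auto simp: one_strop_def)

lemma level_star [simp]: "level (star a) = - level a"
  and is_Tangible_star [simp]: "is_Tangible (star a) \<longleftrightarrow> is_Tangible a"
  by (auto simp: star_def split: strop.splits)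

lemma star_one [simp]: "star 1 = 1"
  by (rule strop_eqI) auto

lemma star_mult: "star (a * b) = star a * star b"
  by (rule strop_eqI) auto

lemma star_star [simp]: "star (star a) = a"
  by (rule strop_eqI) auto

lemma level_power [simp]: "level (a ^ n) = of_nat n * level a"
  by (induction n) (auto simp: algebra_simps)

lemma level_prod [simp]: "level (prod f A) = (\<Sum>i\<in>A. level (f i))"
  by (induction A rule: infinite_finite_induct) auto

lemma nu_cong_iff: "f \<cong>\<^sub>\<nu> g \<longleftrightarrow> (\<forall>x. level (f x) = level (g x))"
  by (auto simp: nu_cong_def nu_def)

lemma level_ne_sum:
  assumes "finite A" "A \<noteq> {}"
  shows "level (ne_sum f A) = Max ((\<lambda>i. level (f i)) ` A)"
  using assms by (induction rule: finite_ne_induct) (auto simp: ne_sum_insert)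

lemma level_ne_sum_less_iff:
  assumes "finite A" "A \<noteq> {}"
  shows "level (ne_sum f A) < t \<longleftrightarrow> (\<forall>i\<in>A. level (f i) < t)"
  using assms by (simp add: level_ne_sum)

text \<open>A ghost value arises from a tie at the maximum or from a ghost term that dominates. This
  criterion is what later decides equality of polynomial functions beyond their levels.\<close>

lemma is_Tangible_ne_sum:
  assumes "finite A" "A \<noteq> {}"
  shows "is_Tangible (ne_sum f A) \<longleftrightarrow>
    (\<exists>i\<in>A. is_Tangible (f i) \<and> (\<forall>j\<in>A - {i}. level (f j) < level (f i)))"
  using assms
proof (induction rule: finite_ne_induct)
  case (singleton i)
  then show ?case by simp
next
  case (insert i A)
  have max_less: "level (f i) < level (ne_sum f A) \<longleftrightarrow> (\<exists>j\<in>A. level (f i) < level (f j))"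
    using insert.hyps by (auto simp: level_ne_sum Max_gr_iff)
  have "is_Tangible (ne_sum f (insert i A)) \<longleftrightarrow>
      is_Tangible (f i) \<and> (\<forall>j\<in>A. level (f j) < level (f i)) \<or>
      (\<exists>k\<in>A. is_Tangible (f k) \<and> (\<forall>j\<in>A - {k}. level (f j) < level (f k))) \<and>
      (\<exists>j\<in>A. level (f i) < level (f j))"
    using insert.hyps insert.IH
    by (simp add: ne_sum_insert is_Tangible_plus level_ne_sum_less_iff max_less)
  \<comment> \<open>The first disjunct is the case \<open>k = i\<close>. In the second,
    \<open>k\<close> already dominates \<open>A\<close>, so the term at \<open>i\<close> lies below
    some term of \<open>A\<close> exactly when it lies below the one at \<open>k\<close>.\<close>
  also have "\<dots> \<longleftrightarrow> (\<exists>k\<in>insert i A. is_Tangible (f k) \<and>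
      (\<forall>j\<in>insert i A - {k}. level (f j) < level (f k)))"
    using insert.hyps(3) by (auto; smt (verit, best) Diff_iff insert_iff singletonD)
  finally show ?case .
qed

section \<open>Polynomials as maxima of their terms\<close>

definition term_eval :: "'n::finite trop_poly \<Rightarrow> ('n \<Rightarrow> strop) \<Rightarrow> ('n \<Rightarrow> nat) \<Rightarrow> strop" where
  "term_eval p a e = the (p e) * (\<Prod>i\<in>UNIV. a i ^ e i)"

lemma poly_eval_eq: "poly_eval p a = ne_sum (term_eval p a) (dom p)"
  by (simp add: poly_eval_def term_eval_def[abs_def])

lemma monomial_add:
  "(\<Prod>i\<in>UNIV. a i ^ (d + e) i) = (\<Prod>i\<in>UNIV. a i ^ d i) * (\<Prod>i\<in>UNIV. (a i :: strop) ^ e i)"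
  by (simp add: power_add prod.distrib)

lemma level_poly_eval:
  assumes "is_poly p"
  shows "level (poly_eval p a) = Max ((\<lambda>e. level (term_eval p a e)) ` dom p)"
  using assms by (simp add: is_poly_def poly_eval_eq level_ne_sum)

lemma term_le_poly_eval:
  assumes "is_poly p" "e \<in> dom p"
  shows "level (term_eval p a e) \<le> level (poly_eval p a)"
  using assms by (simp add: level_poly_eval is_poly_def)

lemma poly_eval_attained:
  assumes "is_poly p"
  obtains e where "e \<in> dom p" "level (poly_eval p a) = level (term_eval p a e)"
proof -
  have "level (poly_eval p a) \<in> (\<lambda>e. level (term_eval p a e)) ` dom p"
    using assms unfolding level_poly_eval[OF assms] by (intro Max_in) (auto simp: is_poly_def)
  with that show thesis by auto
qed

lemma level_poly_eval_eqI:
  assumes "is_poly p" "\<And>e. e \<in> dom p \<Longrightarrow> level (term_eval p a e) \<le> t"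
    and "e0 \<in> dom p" "t \<le> level (term_eval p a e0)"
  shows "level (poly_eval p a) = t"
  using assms by (intro antisym) (metis poly_eval_attained, metis order_trans term_le_poly_eval)

lemma is_Tangible_poly_eval:
  assumes "is_poly p"
  shows "is_Tangible (poly_eval p a) \<longleftrightarrow> (\<exists>e\<in>dom p. is_Tangible (term_eval p a e) \<and>
    (\<forall>d\<in>dom p - {e}. level (term_eval p a d) < level (term_eval p a e)))"
  using assms by (simp add: is_poly_def poly_eval_eq is_Tangible_ne_sum)

text \<open>The coefficients of the honest product of two polynomials with tangible coefficients may be
  ghost. Keeping, for each exponent, only one pair of terms with maximal coefficient does not
  change the function: a point where two pairs tie is a ghost point of one of the factors.\<close>

lemma poly_mult:
  fixes p q :: "'n::finite trop_poly"
  assumes p: "is_poly p" and q: "is_poly q"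
  obtains r where "is_poly r" "\<And>a. poly_eval r a = poly_eval p a * poly_eval q a"
    "tangible_coeffs p \<Longrightarrow> tangible_coeffs q \<Longrightarrow> tangible_coeffs r"
proof -
  define R where "R e = {(d1, d2). d1 \<in> dom p \<and> d2 \<in> dom q \<and> d1 + d2 = e}" for e
  define D where "D = (\<lambda>(d1, d2). d1 + d2) ` (dom p \<times> dom q)"
  \<comment> \<open>Pairs with the same sum of exponents share their monomial, so comparing
    coefficient levels compares the terms at every point simultaneously.\<close>
  define w where "w = (\<lambda>(d1, d2). level (the (p d1)) + level (the (q d2)))"
  have "\<exists>x\<in>R e. \<forall>y\<in>R e. w y \<le> w x" if "e \<in> D" for e
  proof -
    have "finite (R e)"
      by (rule finite_subset[of _ "dom p \<times> dom q"]) (use p q in \<open>auto simp: R_def is_poly_def\<close>)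
    moreover have "R e \<noteq> {}"
      using that by (auto simp: R_def D_def)
    ultimately have "Max (w ` R e) \<in> w ` R e"
      by (intro Max_in) auto
    then show ?thesis
      using \<open>finite (R e)\<close> by (metis Max_ge finite_imageI image_iff)
  qed
  then obtain s where s: "\<And>e. e \<in> D \<Longrightarrow> s e \<in> R e" "\<And>e y. e \<in> D \<Longrightarrow> y \<in> R e \<Longrightarrow> w y \<le> w (s e)"
    by metis
  define r where
    "r e = (if e \<in> D then Some (the (p (fst (s e))) * the (q (snd (s e)))) else None)" for e
  have dom_r: "dom r = D"
    by (auto simp: r_def dom_def)
  have r: "is_poly r"
    using p q by (auto simp: is_poly_def dom_r D_def)
  have s': "fst (s e) \<in> dom p" "snd (s e) \<in> dom q" "fst (s e) + snd (s e) = e" if "e \<in> D" for e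
    using s(1)[OF that] by (auto simp: R_def)
  have term_r: "term_eval r a e = term_eval p a (fst (s e)) * term_eval q a (snd (s e))"
    if "e \<in> D" for a e
  proof -
    have "(\<Prod>i\<in>UNIV. a i ^ e i) =
        (\<Prod>i\<in>UNIV. a i ^ fst (s e) i) * (\<Prod>i\<in>UNIV. a i ^ snd (s e) i)"
      using monomial_add[of a "fst (s e)" "snd (s e)"] s'(3)[OF that] by simp
    then show ?thesis
      using that by (simp add: term_eval_def r_def mult_ac)
  qed
  have DI: "d1 + d2 \<in> D" if "d1 \<in> dom p" "d2 \<in> dom q" for d1 d2
    using that by (auto simp: D_def)
  have term_le: "level (term_eval p a d1) + level (term_eval q a d2) \<le> level (term_eval r a (d1 + d2))"
    if "d1 \<in> dom p" "d2 \<in> dom q" for a d1 d2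
  proof -
    have "w (d1, d2) \<le> w (s (d1 + d2))"
      using that DI[OF that] by (intro s(2)) (auto simp: R_def)
    moreover have "level (\<Prod>i\<in>UNIV. a i ^ (d1 + d2) i) =
        level (\<Prod>i\<in>UNIV. a i ^ d1 i) + level (\<Prod>i\<in>UNIV. a i ^ d2 i)"
      by (simp only: monomial_add level_mult)
    ultimately show ?thesis
      using DI[OF that] by (simp add: term_eval_def r_def w_def case_prod_unfold del: level_prod plus_fun_apply)
  qed
  have eval: "poly_eval r a = poly_eval p a * poly_eval q a" for a
  proof (rule strop_eqI)
    obtain d1 where d1: "d1 \<in> dom p" "level (poly_eval p a) = level (term_eval p a d1)"
      using poly_eval_attained[OF p] .
    obtain d2 where d2: "d2 \<in> dom q" "level (poly_eval q a) = level (term_eval q a d2)"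
      using poly_eval_attained[OF q] .
    show "level (poly_eval r a) = level (poly_eval p a * poly_eval q a)"
    proof (rule level_poly_eval_eqI[OF r])
      show "level (term_eval r a e) \<le> level (poly_eval p a * poly_eval q a)" if "e \<in> dom r" for e
        using that s'[of e] by (simp add: dom_r term_r add_mono term_le_poly_eval p q)
      show "d1 + d2 \<in> dom r"
        using d1 d2 DI by (simp add: dom_r)
      show "level (poly_eval p a * poly_eval q a) \<le> level (term_eval r a (d1 + d2))"
        using term_le[OF d1(1) d2(1)] d1 d2 by simp
    qed
    show "is_Tangible (poly_eval r a) \<longleftrightarrow> is_Tangible (poly_eval p a * poly_eval q a)"
    proof
      assume "is_Tangible (poly_eval r a)"
      then obtain e where e: "e \<in> D" "is_Tangible (term_eval r a e)"
        and uniq: "\<And>d. d \<in> D \<Longrightarrow> d \<noteq> e \<Longrightarrow> level (term_eval r a d) < level (term_eval r a e)"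
        by (auto simp: is_Tangible_poly_eval[OF r] dom_r)
      define e1 e2 where "e1 = fst (s e)" and "e2 = snd (s e)"
      have e12: "e1 \<in> dom p" "e2 \<in> dom q" "e1 + e2 = e"
        and lev: "level (term_eval r a e) = level (term_eval p a e1) + level (term_eval q a e2)"
        and tan: "is_Tangible (term_eval p a e1)" "is_Tangible (term_eval q a e2)"
        using s'[OF e(1)] term_r[OF e(1), of a] e(2) by (simp_all add: e1_def e2_def)
      \<comment> \<open>A competitor \<open>d\<close> of \<open>e1\<close> gives the exponent
        \<open>d + e2\<close>, different from \<open>e\<close> by cancellation. Its term in
        \<open>r\<close> is strictly smaller, and the common contribution of \<open>e2\<close>
        cancels.\<close>
      have "level (term_eval p a d) < level (term_eval p a e1)" if "d \<in> dom p - {e1}" for d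
      proof -
        have "d + e2 \<noteq> e"
          using that e12(3) by auto
        then show ?thesis
          using uniq[of "d + e2"] DI[of d e2] term_le[of d e2 a] that e12 lev by fastforce
      qed
      moreover have "level (term_eval q a d) < level (term_eval q a e2)" if "d \<in> dom q - {e2}" for d
      proof -
        have "e1 + d \<noteq> e"
          using that e12(3) by auto
        then show ?thesis
          using uniq[of "e1 + d"] DI[of e1 d] term_le[of e1 d a] that e12 lev by fastforce
      qed
      ultimately show "is_Tangible (poly_eval p a * poly_eval q a)"
        using e12 tan by (auto simp: is_Tangible_poly_eval p q)
    next
      assume "is_Tangible (poly_eval p a * poly_eval q a)"
      then have "is_Tangible (poly_eval p a)" "is_Tangible (poly_eval q a)"
        by simp_all
      then obtain e1 e2 where e: "e1 \<in> dom p" "e2 \<in> dom q"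
          "is_Tangible (term_eval p a e1)" "is_Tangible (term_eval q a e2)"
        and uniq: "\<And>d. d \<in> dom p \<Longrightarrow> d \<noteq> e1 \<Longrightarrow> level (term_eval p a d) < level (term_eval p a e1)"
          "\<And>d. d \<in> dom q \<Longrightarrow> d \<noteq> e2 \<Longrightarrow> level (term_eval q a d) < level (term_eval q a e2)"
        unfolding is_Tangible_poly_eval[OF p] is_Tangible_poly_eval[OF q]
        by (metis Diff_iff singletonD)
      have le: "level (term_eval p a d) \<le> level (term_eval p a e1)" if "d \<in> dom p" for d
        using uniq(1)[OF that] by (cases "d = e1") auto
      have le': "level (term_eval q a d) \<le> level (term_eval q a e2)" if "d \<in> dom q" for d
        using uniq(2)[OF that] by (cases "d = e2") auto
      have less: "level (term_eval r a d) < level (term_eval p a e1) + level (term_eval q a e2)"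
        if "d \<in> D" "s d \<noteq> (e1, e2)" for d
      proof -
        have "fst (s d) \<noteq> e1 \<or> snd (s d) \<noteq> e2"
          using that(2) by (metis prod.collapse)
        then show ?thesis
          using uniq(1)[of "fst (s d)"] uniq(2)[of "snd (s d)"] le[of "fst (s d)"] le'[of "snd (s d)"]
            s'[OF that(1)] by (auto simp: term_r[OF that(1)])
      qed
      let ?e = "e1 + e2"
      \<comment> \<open>Any other choice of pair would make the term at \<open>e1 + e2\<close>
        strictly smaller than the product of the two dominant terms, contradicting the maximal
        choice.\<close>
      have se: "s ?e = (e1, e2)"
        using less[OF DI[OF e(1,2)]] term_le[OF e(1,2), of a] by fastforce
      have term_e: "term_eval r a ?e = term_eval p a e1 * term_eval q a e2"
        using term_r[OF DI[OF e(1,2)]] se by simp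
      have "level (term_eval r a d) < level (term_eval r a ?e)" if "d \<in> D - {?e}" for d
      proof -
        have "s d \<noteq> (e1, e2)"
          using that s'(3)[of d] by force
        then show ?thesis
          using that less[of d] by (simp add: term_e)
      qed
      then show "is_Tangible (poly_eval r a)"
        using DI[OF e(1,2)] e(3,4) term_e unfolding is_Tangible_poly_eval[OF r] dom_r
        by (intro bexI[of _ ?e]) simp_all
    qed
  qed
  have tan: "tangible_coeffs r" if "tangible_coeffs p" "tangible_coeffs q"
  proof -
    have T: "is_Tangible (the (t e))" if "tangible_coeffs t" "e \<in> dom t" for t :: "'n trop_poly" and e
    proof -
      have "the (t e) \<in> ran t"
        using that(2) by (auto intro: ranI)
      with that(1) show ?thesis
        by (auto simp: tangible_coeffs_def)
    qed
    have R: "x \<in> range Tangible" if "is_Tangible x" for x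
      using that by (cases x) auto
    show ?thesis
      unfolding tangible_coeffs_def
    proof
      fix x assume "x \<in> ran r"
      then obtain e where "e \<in> D" "x = the (p (fst (s e))) * the (q (snd (s e)))"
        by (auto simp: ran_def r_def split: if_splits)
      with s' that show "x \<in> range Tangible"
        by (intro R) (simp add: T)
    qed
  qed
  from that[OF r eval tan] show thesis .
qed

text \<open>Adding coefficients at common exponents takes the maximum of the levels term by term.
  The result supplies the numerator for absolute values of rational functions.\<close>

lemma poly_max:
  fixes p q :: "'n::finite trop_poly"
  assumes p: "is_poly p" and q: "is_poly q"
  obtains r where "is_poly r"
    "\<And>a. level (poly_eval r a) = max (level (poly_eval p a)) (level (poly_eval q a))"
proof -
  define r where "r e = (case p e of None \<Rightarrow> q e |
    Some x \<Rightarrow> (case q e of None \<Rightarrow> Some x | Some y \<Rightarrow> Some (x + y)))" for e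
  have dom_r: "dom r = dom p \<union> dom q"
    by (auto simp: r_def dom_def split: option.splits)
  have r: "is_poly r"
    using p q by (auto simp: is_poly_def dom_r)
  have term_r: "level (term_eval r a e) =
      (if e \<in> dom p then if e \<in> dom q then max (level (term_eval p a e)) (level (term_eval q a e))
        else level (term_eval p a e) else level (term_eval q a e))" for a e
    by (auto simp: term_eval_def r_def dom_def split: option.splits)
  have "level (poly_eval r a) = max (level (poly_eval p a)) (level (poly_eval q a))" for a
  proof (rule antisym)
    obtain e where e: "e \<in> dom r" "level (poly_eval r a) = level (term_eval r a e)"
      using poly_eval_attained[OF r] .
    then show "level (poly_eval r a) \<le> max (level (poly_eval p a)) (level (poly_eval q a))"
      using term_le_poly_eval[OF p, of e a] term_le_poly_eval[OF q, of e a]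
      by (cases "e \<in> dom p"; cases "e \<in> dom q"; simp add: term_r dom_r; linarith)
    obtain d1 where "d1 \<in> dom p" "level (poly_eval p a) = level (term_eval p a d1)"
      using poly_eval_attained[OF p] .
    moreover obtain d2 where "d2 \<in> dom q" "level (poly_eval q a) = level (term_eval q a d2)"
      using poly_eval_attained[OF q] .
    ultimately show "max (level (poly_eval p a)) (level (poly_eval q a)) \<le> level (poly_eval r a)"
      using term_le_poly_eval[OF r, of d1 a] term_le_poly_eval[OF r, of d2 a]
      by (cases "d1 \<in> dom q"; cases "d2 \<in> dom p"; simp add: term_r dom_r; linarith)
  qed
  with that r show thesis by blast
qed

text \<open>Turns an arbitrary numerator into an admissible denominator without changing the level
  of any value.\<close>

definition tangible_lift :: "'n trop_poly \<Rightarrow> 'n trop_poly" where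
  "tangible_lift p = map_option (Tangible \<circ> level) \<circ> p"

lemma dom_tangible_lift [simp]: "dom (tangible_lift p) = dom p"
  by (auto simp: tangible_lift_def dom_def)

lemma is_poly_tangible_lift [simp]: "is_poly (tangible_lift p) \<longleftrightarrow> is_poly p"
  by (simp add: is_poly_def)

lemma tangible_coeffs_tangible_lift [simp]: "tangible_coeffs (tangible_lift p)"
  by (auto simp: tangible_coeffs_def tangible_lift_def ran_def)

lemma level_term_eval_tangible_lift:
  "e \<in> dom p \<Longrightarrow> level (term_eval (tangible_lift p) a e) = level (term_eval p a e)"
  by (auto simp: term_eval_def tangible_lift_def)

lemma level_poly_eval_tangible_lift [simp]:
  assumes "is_poly p"
  shows "level (poly_eval (tangible_lift p) a) = level (poly_eval p a)"
  using assms by (simp add: level_poly_eval level_term_eval_tangible_lift cong: image_cong_simp)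

text \<open>The unique dominant tangible term stays dominant and tangible. The converse fails, as a
  ghost constant shows.\<close>

lemma is_Tangible_poly_eval_tangible_lift:
  assumes "is_poly p" "is_Tangible (poly_eval p a)"
  shows "is_Tangible (poly_eval (tangible_lift p) a)"
proof -
  have "is_Tangible (term_eval (tangible_lift p) a e)" if "e \<in> dom p" "is_Tangible (term_eval p a e)" for e
    using that by (auto simp: term_eval_def tangible_lift_def)
  then show ?thesis
    using assms by (fastforce simp: is_Tangible_poly_eval level_term_eval_tangible_lift)
qed

section \<open>Arithmetic of rational functions\<close>

lemma ratfunI:
  assumes "is_poly p" "is_poly q" "tangible_coeffs q"
  shows "(\<lambda>a. poly_eval p a * star (poly_eval q a)) \<in> ratfun"
  using assms by (auto simp: ratfun_def)

lemma ratfunE: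
  assumes "f \<in> ratfun"
  obtains p q where "is_poly p" "is_poly q" "tangible_coeffs q"
    "\<And>a. f a = poly_eval p a * star (poly_eval q a)"
  using assms by (auto simp: ratfun_def)

lemma ratfun_mult:
  assumes "f \<in> ratfun" "g \<in> ratfun"
  shows "f * g \<in> ratfun"
proof -
  obtain p q where f: "is_poly p" "is_poly q" "tangible_coeffs q"
    "\<And>a. f a = poly_eval p a * star (poly_eval q a)"
    using ratfunE[OF assms(1)] by blast
  obtain p' q' where g: "is_poly p'" "is_poly q'" "tangible_coeffs q'"
    "\<And>a. g a = poly_eval p' a * star (poly_eval q' a)"
    using ratfunE[OF assms(2)] by blast
  obtain r where r: "is_poly r" "\<And>a. poly_eval r a = poly_eval p a * poly_eval p' a"
    using poly_mult[OF f(1) g(1)] by blast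
  obtain t where t: "is_poly t" "tangible_coeffs t" "\<And>a. poly_eval t a = poly_eval q a * poly_eval q' a"
    using poly_mult[OF f(2) g(2)] f(3) g(3) by metis
  have "f * g = (\<lambda>a. poly_eval r a * star (poly_eval t a))"
    by (simp add: fun_eq_iff r t f g star_mult mult_ac)
  with ratfunI[OF r(1) t(1,2)] show ?thesis by simp
qed

text \<open>A numerator with ghost coefficients may not become a denominator, so \<open>p\<^sup>*\<close> is written as
  \<open>p (p'\<^sup>2)\<^sup>*\<close>, where \<open>p'\<close> is \<open>p\<close> with tangible coefficients.\<close>

lemma ratfun_star:
  assumes "f \<in> ratfun"
  shows "star \<circ> f \<in> ratfun"
proof -
  obtain p q where f: "is_poly p" "is_poly q" "tangible_coeffs q"
    "\<And>a. f a = poly_eval p a * star (poly_eval q a)"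
    using ratfunE[OF assms] by blast
  let ?p = "tangible_lift p"
  obtain r where r: "is_poly r" "\<And>a. poly_eval r a = poly_eval q a * poly_eval p a"
    using poly_mult[OF f(2,1)] by blast
  obtain t where t: "is_poly t" "tangible_coeffs t" "\<And>a. poly_eval t a = poly_eval ?p a * poly_eval ?p a"
    using poly_mult[of ?p ?p] f(1) by (metis is_poly_tangible_lift tangible_coeffs_tangible_lift)
  \<comment> \<open>On levels this is \<open>- x = x - 2 * x\<close>. The factor
    \<open>poly_eval p a\<close> carries the ghost status, since the lift is tangible wherever
    \<open>p\<close> is.\<close>
  have "star (poly_eval p a) = poly_eval p a * star (poly_eval t a)" for a
    using is_Tangible_poly_eval_tangible_lift[OF f(1), of a] f(1) by (intro strop_eqI) (auto simp: t)
  then have "star \<circ> f = (\<lambda>a. poly_eval r a * star (poly_eval t a))"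
    by (simp add: fun_eq_iff r f star_mult mult_ac)
  with ratfunI[OF r(1) t(1,2)] show ?thesis by simp
qed

lemma ratfun_const: "(\<lambda>_. c) \<in> ratfun"
proof -
  define m :: "strop \<Rightarrow> 'a trop_poly" where "m x = [(\<lambda>_. 0) \<mapsto> x]" for x
  have "is_poly (m x)" "poly_eval (m x) a = x" for x a
    by (simp_all add: m_def is_poly_def poly_eval_def)
  moreover have "tangible_coeffs (m 1)"
    by (simp add: m_def tangible_coeffs_def one_strop_def)
  ultimately show ?thesis
    using ratfunI[of "m c" "m 1"] by simp
qed

lemma ratfun_one: "1 \<in> ratfun"
  using ratfun_const[of 1] by (simp add: one_fun_def)

text \<open>In levels, \<open>\<bar>p - q\<bar> = max (2 * p) (2 * q) - (p + q)\<close>. In the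
  denominator \<open>p\<close> is replaced by its tangible lift.\<close>

lemma ratfun_abs:
  assumes "f \<in> ratfun"
  obtains c where "c \<in> ratfun" "\<And>a. level (c a) = \<bar>level (f a)\<bar>"
proof -
  obtain p q where f: "is_poly p" "is_poly q" "tangible_coeffs q"
    "\<And>a. f a = poly_eval p a * star (poly_eval q a)"
    using ratfunE[OF assms] by blast
  obtain p2 where p2: "is_poly p2" "\<And>a. poly_eval p2 a = poly_eval p a * poly_eval p a"
    using poly_mult[OF f(1,1)] by blast
  obtain q2 where q2: "is_poly q2" "\<And>a. poly_eval q2 a = poly_eval q a * poly_eval q a"
    using poly_mult[OF f(2,2)] by blast
  obtain r where r: "is_poly r"
    "\<And>a. level (poly_eval r a) = max (level (poly_eval p2 a)) (level (poly_eval q2 a))"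
    using poly_max[OF p2(1) q2(1)] by blast
  obtain t where t: "is_poly t" "tangible_coeffs t"
    "\<And>a. poly_eval t a = poly_eval (tangible_lift p) a * poly_eval q a"
    using poly_mult[of "tangible_lift p" q] f by (metis is_poly_tangible_lift tangible_coeffs_tangible_lift)
  show thesis
    by (rule that[OF ratfunI[OF r(1) t(1,2)]]) (use f(1) in \<open>auto simp: r(2) p2 q2 t(3) f(4)\<close>)
qed

section \<open>Levels of rational functions as piecewise affine functions\<close>

lemma piecewise_affine_level_poly_eval:
  fixes p :: "'n::finite trop_poly"
  assumes "is_poly p"
  shows "piecewise_affine (\<lambda>y :: real^'n. level (poly_eval p (\<lambda>i. Tangible (y $ i))))"
proof -
  \<comment> \<open>The level of a term is affine in the levels of the variables: the exponent
    vector is its slope and the coefficient level its constant part.\<close>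
  define c where "c e = ((\<chi> i. real (e i)) :: real^'n, level (the (p e)))" for e
  have "level (poly_eval p (\<lambda>i. Tangible (y $ i))) = Max ((\<lambda>s. s \<odot> y) ` c ` dom p)" for y :: "real^'n"
    unfolding level_poly_eval[OF assms]
    by (simp add: image_image c_def term_eval_def inner_vec_def add.commute)
  with piecewise_affine_Max[of "c ` dom p"] assms show ?thesis
    by (simp add: is_poly_def)
qed

lemma piecewise_affine_level_ratfun:
  fixes f :: "('n::finite \<Rightarrow> strop) \<Rightarrow> strop"
  assumes "f \<in> ratfun"
  shows "piecewise_affine (\<lambda>y :: real^'n. level (f (\<lambda>i. Tangible (y $ i))))"
proof -
  obtain p q where f: "is_poly p" "is_poly q"
    "\<And>a. f a = poly_eval p a * star (poly_eval q a)"
    using ratfunE[OF assms] by blast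
  show ?thesis
    using piecewise_affine_diff[OF f(1,2)[THEN piecewise_affine_level_poly_eval]] by (simp add: f(3))
qed

text \<open>Levels of values depend only on levels of arguments, so comparisons of levels reduce to
  tangible points, that is, to real vectors.\<close>

lemma level_ratfun_tangible:
  assumes "f \<in> ratfun"
  shows "level (f a) = level (f (\<lambda>i. Tangible (level (a i))))"
proof -
  obtain p q where f: "is_poly p" "is_poly q"
    "\<And>a. f a = poly_eval p a * star (poly_eval q a)"
    using ratfunE[OF assms] by blast
  have "level (poly_eval t a) = level (poly_eval t (\<lambda>i. Tangible (level (a i))))"
    if "is_poly t" for t
    using that by (simp add: level_poly_eval term_eval_def)
  from this[OF f(1)] this[OF f(2)] show ?thesis
    by (simp only: f(3) level_mult level_star)
qed

subsection \<open>Kernels\<close>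

lemma bounded_ratfun_kernel:
  "is_nu_kernel {f \<in> ratfun. \<exists>M. \<forall>a. \<bar>level (f a)\<bar> \<le> M}"
  unfolding is_nu_kernel_def
proof (intro conjI ballI impI)
  let ?K = "{f \<in> ratfun. \<exists>M. \<forall>a. \<bar>level (f a)\<bar> \<le> M}"
  show "1 \<in> ?K"
    by (auto simp: ratfun_one)
  show "f * g \<in> ?K" if f: "f \<in> ?K" and g: "g \<in> ?K" for f g
  proof -
    obtain M N where MN: "\<And>a. \<bar>level (f a)\<bar> \<le> M" "\<And>a. \<bar>level (g a)\<bar> \<le> N"
      using f g by blast
    have "\<bar>level ((f * g) a)\<bar> \<le> M + N" for a
      using abs_triangle_ineq[of "level (f a)" "level (g a)"] MN[of a] by simp
    moreover have "f * g \<in> ratfun"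
      using f g by (simp add: ratfun_mult)
    ultimately show ?thesis by blast
  qed
  show "star \<circ> f \<in> ?K" if "f \<in> ?K" for f
    using that by (auto intro: ratfun_star)
  fix f g \<alpha> \<beta> c
  assume f: "f \<in> ?K" and g: "g \<in> ?K" and \<alpha>\<beta>: "\<alpha> + \<beta> \<cong>\<^sub>\<nu> 1" and c: "c \<in> ratfun" "c \<cong>\<^sub>\<nu> \<alpha> * f + \<beta> * g"
  obtain M N where MN: "\<And>a. \<bar>level (f a)\<bar> \<le> M" "\<And>a. \<bar>level (g a)\<bar> \<le> N"
    using f g by blast
  \<comment> \<open>The levels of \<alpha> and \<beta> have maximum 0 at every point. Both are at
    most 0, which gives the upper bound; whichever equals 0 gives the lower bound.\<close>
  have "\<bar>level (c a)\<bar> \<le> max M N" for a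
  proof -
    have "max (level (\<alpha> a)) (level (\<beta> a)) = 0"
      "level (c a) = max (level (\<alpha> a) + level (f a)) (level (\<beta> a) + level (g a))"
      using \<alpha>\<beta> c(2) by (auto simp: nu_cong_iff)
    then show ?thesis
      using MN[of a] by linarith
  qed
  with c(1) show "c \<in> ?K" by blast
qed auto

lemma bounded_of_mem_kernel_constants:
  assumes "f \<in> nu_kernel_gen constants"
  obtains M where "\<And>a. \<bar>level (f a)\<bar> \<le> M"
proof -
  have "constants \<subseteq> {f \<in> ratfun. \<exists>M. \<forall>a. \<bar>level (f a)\<bar> \<le> M}"
    by (auto simp: constants_def ratfun_const)
  then have "nu_kernel_gen constants \<subseteq> {f \<in> ratfun. \<exists>M. \<forall>a. \<bar>level (f a)\<bar> \<le> M}"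
    unfolding nu_kernel_gen_def by (rule hull_minimal) (rule bounded_ratfun_kernel)
  with assms that show thesis by blast
qed

lemma ratfun_le_multiple_abs:
  fixes f h :: "('n::finite \<Rightarrow> strop) \<Rightarrow> strop"
  assumes f: "f \<in> ratfun" and h: "h \<in> ratfun"
    and bdd: "\<And>a. \<bar>level (f a)\<bar> \<le> M"
    and zero: "\<And>a. level (h a) = 0 \<Longrightarrow> level (f a) = 0"
  obtains N :: nat where "\<And>a. \<bar>level (f a)\<bar> \<le> N * \<bar>level (h a)\<bar>"
proof -
  define T :: "real^'n \<Rightarrow> 'n \<Rightarrow> strop" where "T y = (\<lambda>i. Tangible (y $ i))" for y
  have "\<exists>N\<ge>0. \<forall>y. \<bar>level (f (T y))\<bar> \<le> N * \<bar>level (h (T y))\<bar>"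
    unfolding T_def
    by (rule piecewise_affine_le_multiple[OF piecewise_affine_abs piecewise_affine_abs])
      (use bdd zero in \<open>auto intro: piecewise_affine_level_ratfun f h\<close>)
  then obtain N where N: "\<And>y. \<bar>level (f (T y))\<bar> \<le> N * \<bar>level (h (T y))\<bar>"
    by blast
  \<comment> \<open>The real multiplier is rounded up because it becomes the exponent of a power of
    \<open>\<bar>h\<bar>\<close>.\<close>
  have "\<bar>level (f a)\<bar> \<le> real (nat \<lceil>N\<rceil>) * \<bar>level (h a)\<bar>" for a
  proof -
    have "\<bar>level (f a)\<bar> \<le> N * \<bar>level (h a)\<bar>"
      using N[of "\<chi> i. level (a i)"] level_ratfun_tangible[OF f, of a] level_ratfun_tangible[OF h, of a]
      by (simp add: T_def)
    also have "\<dots> \<le> real (nat \<lceil>N\<rceil>) * \<bar>level (h a)\<bar>"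
      by (intro mult_right_mono) linarith+
    finally show ?thesis .
  qed
  then show thesis by (rule that)
qed

text \<open>With \<open>k\<close> a power of \<open>h + h\<^sup>*\<close> such that \<open>k\<^sup>* \<le> g \<le> k\<close>, one has \<open>g = (g k\<^sup>*) k + k\<^sup>*\<close>.\<close>

lemma kernel_mem_of_le_multiple_abs:
  fixes N :: nat
  assumes K: "is_nu_kernel K" and h: "h \<in> K" and g: "g \<in> ratfun"
    and le: "\<And>a. \<bar>level (g a)\<bar> \<le> N * \<bar>level (h a)\<bar>"
  shows "g \<in> K"
proof -
  have comb: "c \<in> K" if "a \<in> K" "b \<in> K" "\<alpha> \<in> ratfun" "\<beta> \<in> ratfun" "\<alpha> + \<beta> \<cong>\<^sub>\<nu> 1"
    "c \<in> ratfun" "c \<cong>\<^sub>\<nu> \<alpha> * a + \<beta> * b" for a b \<alpha> \<beta> c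
    using K that unfolding is_nu_kernel_def by blast
  have mult: "a * b \<in> K" if "a \<in> K" "b \<in> K" for a b
    using K that unfolding is_nu_kernel_def by blast
  have star: "star \<circ> a \<in> K" if "a \<in> K" for a
    using K that unfolding is_nu_kernel_def by blast
  have "h \<in> ratfun"
    using K h unfolding is_nu_kernel_def by blast
  then obtain c where c: "c \<in> ratfun" "\<And>a. level (c a) = \<bar>level (h a)\<bar>"
    using ratfun_abs by blast
  \<comment> \<open>With \<alpha> = \<beta> = 1 the sum is a ghost 1, hence congruent to 1, and
    \<open>c\<close> is a rational representative of \<open>h + h\<^sup>*\<close>.\<close>
  have "c \<in> K"
    by (rule comb[of h "star \<circ> h" 1 1])
      (use h star c in \<open>auto simp: nu_cong_iff ratfun_one\<close>)
  have "\<exists>k\<in>K. \<forall>a. level (k a) = N * \<bar>level (h a)\<bar>"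
  proof (induction N)
    case 0
    have "1 \<in> K"
      using K unfolding is_nu_kernel_def by blast
    then show ?case
      by (intro bexI[of _ 1]) auto
  next
    case (Suc N)
    then obtain k where "k \<in> K" "\<forall>a. level (k a) = N * \<bar>level (h a)\<bar>" by blast
    then show ?case
      using \<open>c \<in> K\<close> by (intro bexI[of _ "c * k"] mult) (auto simp: c algebra_simps)
  qed
  then obtain k where k: "k \<in> K" "\<And>a. \<bar>level (g a)\<bar> \<le> level (k a)"
    using le by auto
  then have "k \<in> ratfun"
    using K unfolding is_nu_kernel_def by blast
  \<comment> \<open>The bound \<open>g \<le> k\<close> keeps the coefficient
    \<open>g k\<^sup>*\<close> at level at most 0, and \<open>- k \<le> g\<close> in levels lets the
    first summand absorb the second.\<close>
  show ?thesis
  proof (rule comb[of k "star \<circ> k" "g * (star \<circ> k)" 1])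
    show "g * (star \<circ> k) \<in> ratfun"
      using g \<open>k \<in> ratfun\<close> by (intro ratfun_mult ratfun_star)
    show "g * (star \<circ> k) + 1 \<cong>\<^sub>\<nu> 1" "g \<cong>\<^sub>\<nu> g * (star \<circ> k) * k + 1 * (star \<circ> k)"
      using k(2) by (auto simp: nu_cong_iff abs_le_iff max_absorb1 max_absorb2 minus_le_iff)
  qed (use g k(1) star ratfun_one in auto)
qed

theorem proposition8p4p2:
  fixes f h :: "('n::finite \<Rightarrow> strop) \<Rightarrow> strop"
  assumes "f \<in> ratfun"
    and "nu_kernel_gen {f} \<subseteq> nu_kernel_gen constants"
    and "h \<in> nu_kernel_gen {f}"
    and "one_loc h = one_loc f"
  shows "is_generator h (nu_kernel_gen {f})"
proof -
  \<comment> \<open>A generated kernel is an intersection of kernels, so comparing two of them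
    reduces to moving a single generator into an arbitrary kernel that contains the other.\<close>
  have hull_le: "nu_kernel_gen {u} \<subseteq> nu_kernel_gen {v}"
    if "\<And>K. is_nu_kernel K \<Longrightarrow> v \<in> K \<Longrightarrow> u \<in> K" for u v :: "('n \<Rightarrow> strop) \<Rightarrow> strop"
    using that unfolding nu_kernel_gen_def hull_def by blast
  have "f \<in> nu_kernel_gen {f}"
    unfolding nu_kernel_gen_def by (simp add: hull_inc)
  then obtain M where M: "\<And>a. \<bar>level (f a)\<bar> \<le> M"
    using assms(2) bounded_of_mem_kernel_constants by blast
  have zero: "level (f a) = 0" if "level (h a) = 0" for a
    using assms(4) that by (auto simp: one_loc_def nu_def set_eq_iff)
  show ?thesis
    unfolding is_generator_def
  proof (intro antisym hull_le)
    show "h \<in> K" if "is_nu_kernel K" "f \<in> K" for K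
      using assms(3) that unfolding nu_kernel_gen_def hull_def by blast
    show "f \<in> K" if K: "is_nu_kernel K" "h \<in> K" for K
    proof -
      have "h \<in> ratfun"
        using K unfolding is_nu_kernel_def by blast
      then obtain N :: nat where "\<And>a. \<bar>level (f a)\<bar> \<le> N * \<bar>level (h a)\<bar>"
        using ratfun_le_multiple_abs[OF assms(1) _ M zero] by blast
      then show ?thesis
        using kernel_mem_of_le_multiple_abs[OF K assms(1)] by blast
    qed
  qed
qed

end
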